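(* Let $v\in C^\infty(\mathbb T^1)$ with $\int_0^1 v(x)\,dx=0$. Let $c$ be the unique number such that $$|1+G'|+v(x)(1+G')=c$$ admits approximate periodic viscosity solutions, and let $\hat c$ be the unique number such that $$(1+v'(x))|1+G'|+v(x)(1+G')=\hat c$$ admits approximate periodic viscosity solutions. Then $$c\ge \hat c .$$ Moreover, if $c>0$, then $c=\hat c$ holds if and only if $v'\equiv 0$.
   Context: $\mathbb T^1=\mathbb R/\mathbb Z$; functions on $\mathbb T^1$ are identified with $1$-periodic functions on $\mathbb R$. An equation $H(u',x)=c$ with $H$ continuous and $1$-periodic in $x$ admits approximate periodic viscosity solutions if for every $\epsilon>0$ there is a continuous $1$-periodic $u_\epsilon$ which is both a viscosity subsolution of $H(u',x)=c+\epsilon$ and a viscosity supersolution of $H(u',x)=c-\epsilon$. The numbers $c$ and $\hat c$ (the flame speeds of the one-dimensional G-equation without and with strain) are well defined and given by: $c=0$ if $\{x: v(x)=-1\}\neq\emptyset$, and otherwise $c=\left(\int_0^1\frac{1}{1+v(x)}dx\right)^{-1}>0$; $\hat c=0$ if $\{x: v'(x)+v(x)=-1\}\ne\emptyset$, and otherwise $\hat c=\left(\int_0^1\frac{1}{1+v'(x)+v(x)}dx\right)^{-1}>0$. *)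

theory Defs
  imports "HOL-Analysis.Analysis"
begin

text \<open>
  Functions on the circle are represented by 1-periodic functions on the real line, i.e. by
  functions satisfying the library predicate \<^locale>\<open>periodic_fun_simple'\<close>.
\<close>

definition smooth :: "(real \<Rightarrow> real) \<Rightarrow> bool" where
  "smooth f \<longleftrightarrow> (\<forall>n. (deriv ^^ n) f differentiable_on UNIV)"

text \<open>
  A Hamiltonian takes the gradient variable first: \<open>H p x\<close> with \<open>p\<close> standing for \<open>u' x\<close>.
  Test functions are \<open>C\<^sup>1\<close> and touch \<open>u\<close> locally, from above for subsolutions and from below
  for supersolutions.
\<close>

definition viscosity_subsolution ::
    "(real \<Rightarrow> real \<Rightarrow> real) \<Rightarrow> real \<Rightarrow> (real \<Rightarrow> real) \<Rightarrow> bool" where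
  "viscosity_subsolution H a u \<longleftrightarrow>
     (\<forall>\<phi> x. \<phi> C1_differentiable_on UNIV \<longrightarrow>
        (\<forall>\<^sub>F y in nhds x. u y - \<phi> y \<le> u x - \<phi> x) \<longrightarrow> H (deriv \<phi> x) x \<le> a)"

definition viscosity_supersolution ::
    "(real \<Rightarrow> real \<Rightarrow> real) \<Rightarrow> real \<Rightarrow> (real \<Rightarrow> real) \<Rightarrow> bool" where
  "viscosity_supersolution H a u \<longleftrightarrow>
     (\<forall>\<phi> x. \<phi> C1_differentiable_on UNIV \<longrightarrow>
        (\<forall>\<^sub>F y in nhds x. u y - \<phi> y \<ge> u x - \<phi> x) \<longrightarrow> H (deriv \<phi> x) x \<ge> a)"

text \<open>Meant for \<open>H\<close> that are continuous and 1-periodic in the second argument.\<close>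

definition admits_approx_solutions :: "(real \<Rightarrow> real \<Rightarrow> real) \<Rightarrow> real \<Rightarrow> bool" where
  "admits_approx_solutions H c \<longleftrightarrow>
     (\<forall>\<epsilon>>0. \<exists>u. continuous_on UNIV u \<and> periodic_fun_simple' u \<and>
        viscosity_subsolution H (c + \<epsilon>) u \<and> viscosity_supersolution H (c - \<epsilon>) u)"

definition G_hamiltonian :: "(real \<Rightarrow> real) \<Rightarrow> real \<Rightarrow> real \<Rightarrow> real" where
  "G_hamiltonian v p x = \<bar>1 + p\<bar> + v x * (1 + p)"

definition strain_G_hamiltonian :: "(real \<Rightarrow> real) \<Rightarrow> real \<Rightarrow> real \<Rightarrow> real" where
  "strain_G_hamiltonian v p x = (1 + deriv v x) * \<bar>1 + p\<bar> + v x * (1 + p)"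

text \<open>Meaningful only for \<open>H\<close> for which exactly one such constant exists.\<close>

definition effective_constant :: "(real \<Rightarrow> real \<Rightarrow> real) \<Rightarrow> real" where
  "effective_constant H = (THE c. admits_approx_solutions H c)"

end

theory Submission
  imports Defs
begin

text \<open>
  Doubling of variables compares any subsolution with any supersolution, so at most one constant
  is admissible. Writing \<open>q = 1 + u'\<close>, both Hamiltonians reduce to \<open>s x * q\<close> where \<open>q \<ge> 0\<close>, with
  \<open>s = 1 + v\<close> and \<open>s = 1 + v + v'\<close> respectively, so a periodic \<open>u\<close> arises from any positive
  periodic \<open>q\<close> of mean 1. If \<open>s\<close> has no zero, \<open>q\<close> proportional to \<open>1 / s\<close> is an exact solution; if
  it has one, \<open>q\<close> proportional to \<open>1 / (\<bar>s\<bar> + \<delta>)\<close> makes \<open>s q\<close> uniformly small, because \<open>1 / \<bar>s\<bar>\<close>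
  is not integrable. The comparison of the two constants for \<open>f = 1 + v\<close> rests on
  \<open>1 / (f + f') - 1 / f + f' / f\<^sup>2 = f'\<^sup>2 / (f\<^sup>2 (f + f'))\<close>, where \<open>f' / f\<^sup>2\<close> has mean zero.
\<close>

section \<open>Periodic functions\<close>

lemma periodic_plus_int:
  fixes f :: "real \<Rightarrow> 'a"
  assumes "periodic_fun_simple' f"
  shows "f (x + of_int n) = f x"
proof (induction n rule: int_induct[where k = 0])
  case (step1 i)
  then show ?case
    using periodic_fun_simple'.plus_period[OF assms, of "x + of_int i"] by (simp add: add_ac)
next
  case (step2 i)
  then show ?case
    using periodic_fun_simple'.plus_period[OF assms, of "x + of_int (i - 1)"] by (simp add: add_ac)
qed simp

lemma periodic_frac:
  fixes f :: "real \<Rightarrow> 'a"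
  assumes "periodic_fun_simple' f"
  shows "f (frac x) = f x"
  using periodic_plus_int[OF assms, of x "- \<lfloor>x\<rfloor>"] by (simp add: frac_def)

lemma periodic_continuous_bounded:
  fixes f :: "real \<Rightarrow> real"
  assumes "periodic_fun_simple' f" "continuous_on UNIV f"
  shows "\<exists>B\<ge>0. \<forall>x. \<bar>f x\<bar> \<le> B"
proof -
  have "compact (f ` {0..1})"
    by (rule compact_continuous_image) (use assms continuous_on_subset in auto)
  then obtain B where B: "\<And>x. x \<in> {0..1} \<Longrightarrow> \<bar>f x\<bar> \<le> B"
    using compact_imp_bounded bounded_iff by (metis image_eqI real_norm_def)
  have "\<bar>f x\<bar> \<le> B" for x
    using B[of "frac x"] periodic_frac[OF assms(1), of x] by (simp add: frac_lt_1 less_imp_le)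
  then show ?thesis
    by (meson abs_ge_zero order_trans)
qed

lemma periodic_deriv:
  fixes f :: "real \<Rightarrow> real"
  assumes "periodic_fun_simple' f" "\<And>x. (f has_real_derivative f' x) (at x)"
  shows "periodic_fun_simple' f'"
proof
  fix x
  have "((\<lambda>x. f (x + 1)) has_real_derivative f' (x + 1)) (at x)"
    using assms(2)[of "x + 1"] by (simp add: DERIV_shift)
  then show "f' (x + 1) = f' x"
    using assms(2)[of x] DERIV_unique periodic_fun_simple'.plus_period[OF assms(1)] by simp
qed

text \<open>A continuous periodic derivative is bounded, so the mean value inequality applies.
  Applied to \<open>v\<close> and \<open>deriv v\<close>, this supplies the constants for both the
  comparison principle and the divergence of the integral of
  \<open>1 / \<bar>s\<bar>\<close>.\<close>

lemma periodic_C1_lipschitz: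
  fixes f :: "real \<Rightarrow> real"
  assumes "periodic_fun_simple' f" "\<And>x. (f has_real_derivative f' x) (at x)"
    and "continuous_on UNIV f'"
  shows "\<exists>L\<ge>0. \<forall>x y. \<bar>f x - f y\<bar> \<le> L * \<bar>x - y\<bar>"
proof -
  obtain L where L: "L \<ge> 0" "\<And>x. \<bar>f' x\<bar> \<le> L"
    using periodic_continuous_bounded[OF periodic_deriv[OF assms(1,2)] assms(3)] by auto
  have "\<bar>f x - f y\<bar> \<le> L * \<bar>x - y\<bar>" for x y
    using field_differentiable_bound[of UNIV f f' L x y] assms(2) L by auto
  with L(1) show ?thesis by blast
qed

section \<open>Comparison and uniqueness\<close>

text \<open>The doubled function is invariant under a common integer shift of both variables, though
  not under separate ones because of the penalty. A common shift brings \<open>x\<close> into the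
  unit interval. A shift of \<open>y\<close> alone can then bring it within distance 1 of
  \<open>x\<close> without raising the penalty, so a maximum over a compact rectangle is
  global.\<close>

lemma doubled_penalization_maximum:
  fixes u w :: "real \<Rightarrow> real"
  assumes u: "continuous_on UNIV u" "periodic_fun_simple' u"
    and w: "continuous_on UNIV w" "periodic_fun_simple' w"
    and K: "K \<ge> 0"
  obtains x0 y0 where "x0 \<in> {0..1}" "y0 \<in> {-1..2}"
    "\<And>x y. u x - w y - K * (x - y)^2 \<le> u x0 - w y0 - K * (x0 - y0)^2"
proof -
  define F where "F = (\<lambda>(x, y). u x - w y - K * (x - y)^2)"
  have "compact ({0..1::real} \<times> {-1..2::real})" "{0..1::real} \<times> {-1..2::real} \<noteq> {}"
    by (auto intro: compact_Times)
  moreover have "continuous_on ({0..1} \<times> {-1..2}) F"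
    unfolding F_def split_beta
    by (intro continuous_intros continuous_on_compose2[OF u(1)] continuous_on_compose2[OF w(1)]) auto
  ultimately obtain p where p: "p \<in> {0..1} \<times> {-1..2}" "\<And>z. z \<in> {0..1} \<times> {-1..2} \<Longrightarrow> F z \<le> F p"
    using continuous_attains_sup by metis
  obtain x0 y0 where xy: "p = (x0, y0)" by fastforce
  have "F (x, y) \<le> F p" for x y
  proof -
    define a where "a = frac x"
    define b where "b = y - of_int \<lfloor>x\<rfloor>"
    \<comment> \<open>A \<open>b\<close> farther than 1 from \<open>a\<close> is replaced by its
      integer translate in [a, a + 1), which keeps \<open>w\<close> and only decreases the distance.
      Since \<open>a\<close> lies in [0, 1), the result lies in [-1, 2].\<close>
    define b' where "b' = (if \<bar>a - b\<bar> \<le> 1 then b else a + frac (b - a))"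
    have "u x = u a"
      using periodic_frac[OF u(2)] by (simp add: a_def)
    moreover have "w y = w b"
      using periodic_plus_int[OF w(2), of y "- \<lfloor>x\<rfloor>"] by (simp add: b_def)
    moreover have "w b = w b'"
      using periodic_plus_int[OF w(2), of b "- \<lfloor>b - a\<rfloor>"] by (simp add: b'_def frac_def algebra_simps)
    moreover have "a - b = x - y"
      by (simp add: a_def b_def frac_def)
    moreover have "\<bar>a - b'\<bar> \<le> \<bar>a - b\<bar>" "\<bar>a - b'\<bar> \<le> 1"
      using frac_lt_1[of "b - a"] frac_ge_0[of "b - a"] by (auto simp: b'_def)
    moreover from this(1) have "K * (a - b')^2 \<le> K * (a - b)^2"
      using K by (intro mult_left_mono) (auto simp: abs_le_square_iff)
    ultimately have "F (x, y) \<le> F (a, b')"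
      by (simp add: F_def)
    also have "\<dots> \<le> F p"
      using \<open>\<bar>a - b'\<bar> \<le> 1\<close> frac_lt_1[of x] frac_ge_0[of x]
      by (intro p(2)) (auto simp flip: a_def)
    finally show ?thesis .
  qed
  then show ?thesis
    using that[of x0 y0] p(1) by (auto simp: F_def xy)
qed

lemma C1_parabola: "(\<lambda>x. K * (x - c)^2) C1_differentiable_on (UNIV :: real set)" for K c :: real
  by (simp add: power2_eq_square)

lemma deriv_parabola: "deriv (\<lambda>x. K * (x - c)^2) x = 2 * K * (x - c)" for K c x :: real
  by (rule DERIV_imp_deriv) (auto intro!: derivative_eq_intros)

text \<open>At a maximum of the doubled function the two parabolas touch \<open>u\<close> and
  \<open>w\<close> with the same slope \<open>p\<close>, so \<open>b - a\<close> is at most the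
  variation of \<open>H p\<close> between \<open>x0\<close> and \<open>y0\<close>. The growth factor
  \<open>1 + \<bar>p\<bar>\<close> is harmless because
  \<open>\<bar>p\<bar> * \<bar>x0 - y0\<bar>\<close> is twice the penalty, which is controlled by
  the oscillation of \<open>u\<close> over a short distance.\<close>

lemma viscosity_comparison:
  fixes H :: "real \<Rightarrow> real \<Rightarrow> real"
  assumes H: "\<And>p x y. \<bar>H p x - H p y\<bar> \<le> L * (1 + \<bar>p\<bar>) * \<bar>x - y\<bar>" and L: "L \<ge> 0"
    and u: "continuous_on UNIV u" "periodic_fun_simple' u" "viscosity_subsolution H a u"
    and w: "continuous_on UNIV w" "periodic_fun_simple' w" "viscosity_supersolution H b w"
  shows "b \<le> a"
proof -
  have key: "b - a \<le> 3 * L * \<eta>" if \<eta>: "\<eta> > 0" for \<eta>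
  proof -
    obtain M where M: "M \<ge> 0" "\<And>x. \<bar>u x\<bar> \<le> M"
      using periodic_continuous_bounded u by metis
    have "uniformly_continuous_on {-1..2} u"
      by (rule compact_uniformly_continuous) (use u continuous_on_subset in auto)
    then obtain d0 where d0: "d0 > 0"
      "\<And>x y. x \<in> {-1..2} \<Longrightarrow> y \<in> {-1..2} \<Longrightarrow> \<bar>x - y\<bar> < d0 \<Longrightarrow> \<bar>u x - u y\<bar> < \<eta>"
      unfolding uniformly_continuous_on_def dist_real_def using \<eta> by metis
    \<comment> \<open>The bound by \<open>d0\<close> makes the oscillation of \<open>u\<close>
      small; the bound by \<open>\<eta>\<close> handles the summand 1 in
      \<open>1 + \<bar>p\<bar>\<close>.\<close>
    define d where "d = min d0 \<eta>"
    have d: "d > 0" "d \<le> d0" "d \<le> \<eta>"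
      using d0 \<eta> by (auto simp: d_def)
    \<comment> \<open>At distance \<open>d\<close> the penalty is \<open>2 * M + 1\<close>, more
      than \<open>u\<close> can oscillate, which forces the maximum point to within \<open>d\<close>
      of the diagonal.\<close>
    define K where "K = (2 * M + 1) / d^2"
    have K: "K > 0"
      using M d by (simp add: K_def)
    obtain x0 y0 where xy: "x0 \<in> {0..1}" "y0 \<in> {-1..2}"
      and max: "\<And>x y. u x - w y - K * (x - y)^2 \<le> u x0 - w y0 - K * (x0 - y0)^2"
      using doubled_penalization_maximum[OF u(1,2) w(1,2), of K] K by (metis less_imp_le)
    \<comment> \<open>Comparison with the diagonal point (y0, y0) cancels \<open>w\<close>, so only
      the modulus of continuity of \<open>u\<close> enters.\<close>
    have pen: "K * (x0 - y0)^2 \<le> u x0 - u y0"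
      using max[of y0 y0] by simp
    also have "\<dots> < 2 * M + 1"
      using M(2)[of x0] M(2)[of y0] by linarith
    also have "\<dots> = K * d^2"
      using d by (simp add: K_def)
    finally have "(x0 - y0)^2 < d^2"
      using K by simp
    then have near: "\<bar>x0 - y0\<bar> < d"
      using d power2_less_imp_less[of "\<bar>x0 - y0\<bar>" d] by simp
    define p where "p = 2 * K * (x0 - y0)"
    have "\<bar>p\<bar> * \<bar>x0 - y0\<bar> = 2 * (K * (x0 - y0)^2)"
      using K by (simp add: p_def abs_mult power2_eq_square)
    also have "\<dots> \<le> 2 * \<eta>"
      using pen d0(2)[of x0 y0] near d xy by auto
    finally have p: "(1 + \<bar>p\<bar>) * \<bar>x0 - y0\<bar> \<le> 3 * \<eta>"
      using near d by (simp add: distrib_right)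
    have "H (deriv (\<lambda>x. K * (x - y0)^2) x0) x0 \<le> a"
    proof -
      have "u x - K * (x - y0)^2 \<le> u x0 - K * (x0 - y0)^2" for x
        using max[of x y0] by simp
      then show ?thesis
        using u(3)[unfolded viscosity_subsolution_def, rule_format, OF C1_parabola[of K y0]]
        by (simp add: always_eventually)
    qed
    \<comment> \<open>The penalty changes sign when \<open>w\<close> is isolated, and so does the
      difference of the variables; the two signs cancel and the slope is again
      \<open>p\<close>.\<close>
    moreover have "H (deriv (\<lambda>y. - K * (y - x0)^2) y0) y0 \<ge> b"
    proof -
      have "w y - (- K * (y - x0)^2) \<ge> w y0 - (- K * (y0 - x0)^2)" for y
        using max[of x0 y] by (simp add: power2_commute)
      then show ?thesis
        using w(3)[unfolded viscosity_supersolution_def, rule_format, OF C1_parabola[of "- K" x0]]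
        by (simp add: always_eventually)
    qed
    ultimately have "b - a \<le> \<bar>H p y0 - H p x0\<bar>"
      unfolding deriv_parabola p_def by (simp add: algebra_simps)
    also have "\<dots> \<le> L * ((1 + \<bar>p\<bar>) * \<bar>x0 - y0\<bar>)"
      using H[of p y0 x0] by (simp add: mult.assoc abs_minus_commute)
    also have "\<dots> \<le> L * (3 * \<eta>)"
      using p L by (rule mult_left_mono)
    finally show ?thesis by simp
  qed
  show ?thesis
  proof (rule field_le_epsilon)
    fix e :: real assume "e > 0"
    \<comment> \<open>The added 1 keeps the denominator positive when \<open>L = 0\<close>.\<close>
    have "b - a \<le> 3 * L * (e / (3 * L + 1))"
      using key[of "e / (3 * L + 1)"] \<open>e > 0\<close> L by simp
    also have "\<dots> \<le> e"
      using L \<open>e > 0\<close> by (simp add: field_simps)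
    finally show "b \<le> a + e" by simp
  qed
qed

lemma admits_approx_solutions_unique:
  fixes H :: "real \<Rightarrow> real \<Rightarrow> real"
  assumes H: "\<And>p x y. \<bar>H p x - H p y\<bar> \<le> L * (1 + \<bar>p\<bar>) * \<bar>x - y\<bar>" and L: "L \<ge> 0"
    and "admits_approx_solutions H c" "admits_approx_solutions H d"
  shows "c = d"
proof -
  have le: "d' \<le> c'" if adm: "admits_approx_solutions H c'" "admits_approx_solutions H d'"
    for c' d'
  proof (rule field_le_epsilon)
    fix e :: real assume "e > 0"
    then have e: "e / 2 > 0" by simp
    obtain u where "continuous_on UNIV u" "periodic_fun_simple' u"
        "viscosity_subsolution H (c' + e / 2) u"
      using adm(1)[unfolded admits_approx_solutions_def, rule_format, OF e] by blast
    moreover obtain w where "continuous_on UNIV w" "periodic_fun_simple' w"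
        "viscosity_supersolution H (d' - e / 2) w"
      using adm(2)[unfolded admits_approx_solutions_def, rule_format, OF e] by blast
    ultimately have "d' - e / 2 \<le> c' + e / 2"
      using viscosity_comparison[OF H L] by blast
    then show "d' \<le> c' + e" by simp
  qed
  from le[OF assms(3,4)] le[OF assms(4,3)] show ?thesis by simp
qed

section \<open>Existence\<close>

text \<open>At a touching point the difference of \<open>u\<close> and the test function has a local
  extremum, so the slopes agree and the viscosity inequality is the pointwise one.\<close>

lemma C1_viscosity_solution:
  fixes u u' :: "real \<Rightarrow> real"
  assumes der: "\<And>x. (u has_real_derivative u' x) (at x)"
  shows "(\<And>x. H (u' x) x \<le> a) \<Longrightarrow> viscosity_subsolution H a u"
    and "(\<And>x. H (u' x) x \<ge> a) \<Longrightarrow> viscosity_supersolution H a u"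
proof -
  have diff: "((\<lambda>y. u y - \<phi> y) has_real_derivative u' x - deriv \<phi> x) (at x)"
    if "\<phi> C1_differentiable_on UNIV" for \<phi> x
  proof -
    have "\<phi> differentiable at x"
      using that by (simp add: C1_differentiable_on_eq)
    then have "(\<phi> has_real_derivative deriv \<phi> x) (at x)"
      using DERIV_deriv_iff_real_differentiable by blast
    with der show ?thesis by (intro DERIV_diff)
  qed
  have touch_above: "deriv \<phi> x = u' x" if \<phi>: "\<phi> C1_differentiable_on UNIV"
    and "\<forall>\<^sub>F y in nhds x. u y - \<phi> y \<le> u x - \<phi> x" for \<phi> x
  proof -
    from that(2) obtain d where d: "d > 0" "\<forall>y. \<bar>x - y\<bar> < d \<longrightarrow> u y - \<phi> y \<le> u x - \<phi> x"
      unfolding eventually_nhds_metric dist_real_def by (auto simp: abs_minus_commute)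
    from DERIV_local_max[OF diff[OF \<phi>] d] show ?thesis by simp
  qed
  show "viscosity_subsolution H a u" if "\<And>x. H (u' x) x \<le> a"
    unfolding viscosity_subsolution_def by (simp add: touch_above that)
  have touch_below: "deriv \<phi> x = u' x" if \<phi>: "\<phi> C1_differentiable_on UNIV"
    and "\<forall>\<^sub>F y in nhds x. u y - \<phi> y \<ge> u x - \<phi> x" for \<phi> x
  proof -
    from that(2) obtain d where d: "d > 0" "\<forall>y. \<bar>x - y\<bar> < d \<longrightarrow> u y - \<phi> y \<ge> u x - \<phi> x"
      unfolding eventually_nhds_metric dist_real_def by (auto simp: abs_minus_commute)
    from DERIV_local_min[OF diff[OF \<phi>] d] show ?thesis by simp
  qed
  show "viscosity_supersolution H a u" if "\<And>x. H (u' x) x \<ge> a"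
    unfolding viscosity_supersolution_def by (simp add: touch_below that)
qed

text \<open>The increment of a primitive of \<open>q\<close> over a period is constant, by
  periodicity of \<open>q\<close>, and equals the integral of \<open>q\<close>. Mean 1 is therefore
  what makes the primitive of \<open>q - 1\<close> periodic.\<close>

lemma periodic_antiderivative:
  fixes q :: "real \<Rightarrow> real"
  assumes q: "continuous_on UNIV q" "periodic_fun_simple' q" and int: "integral {0..1} q = 1"
  obtains u where "periodic_fun_simple' u" "\<And>x. (u has_real_derivative q x - 1) (at x)"
proof -
  obtain F where F: "\<And>x. (F has_real_derivative q x) (at x)"
    using einterval_antiderivative[of "-\<infinity>" "\<infinity>" q] q(1)
    by (auto simp: continuous_on_eq_continuous_at has_real_derivative_iff_has_vector_derivative)
  have "((\<lambda>x. F (x + 1) - F x) has_real_derivative q (x + 1) - q x) (at x)" for x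
    using F by (intro DERIV_diff) (auto simp flip: DERIV_shift)
  then have const: "F (x + 1) - F x = F 1 - F 0" for x
    using DERIV_isconst_all[of "\<lambda>x. F (x + 1) - F x" x 0]
    by (simp add: periodic_fun_simple'.plus_period[OF q(2)])
  have "(q has_integral (F 1 - F 0)) {0..1}"
    by (rule fundamental_theorem_of_calculus)
       (auto intro!: has_field_derivative_at_within[OF F] simp flip: has_real_derivative_iff_has_vector_derivative)
  then have "F 1 - F 0 = 1"
    using int by (simp add: integral_unique)
  with const have "periodic_fun_simple' (\<lambda>x. F x - x)"
    by (simp add: periodic_fun_simple'_def algebra_simps)
  moreover have "((\<lambda>x. F x - x) has_real_derivative q x - 1) (at x)" for x
    by (intro DERIV_diff F DERIV_ident)
  ultimately show ?thesis by (rule that)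
qed

text \<open>Here \<open>q\<close> is \<open>1 + u'\<close>. Its sign keeps \<open>H\<close> on the
  linear branch, and the two-sided error bound lets a single \<open>u\<close> serve as both
  subsolution and supersolution.\<close>

lemma approx_solution_of_slope:
  fixes H :: "real \<Rightarrow> real \<Rightarrow> real"
  assumes H: "\<And>p x. 1 + p \<ge> 0 \<Longrightarrow> H p x = s x * (1 + p)"
    and q: "continuous_on UNIV q" "periodic_fun_simple' q" "integral {0..1} q = 1"
      "\<And>x. q x \<ge> 0" "\<And>x. \<bar>s x * q x - c\<bar> \<le> \<epsilon>"
  shows "\<exists>u. continuous_on UNIV u \<and> periodic_fun_simple' u \<and>
           viscosity_subsolution H (c + \<epsilon>) u \<and> viscosity_supersolution H (c - \<epsilon>) u"
proof -
  obtain u where u: "periodic_fun_simple' u" "\<And>x. (u has_real_derivative q x - 1) (at x)"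
    using periodic_antiderivative[OF q(1-3)] by metis
  have Hq: "H (q x - 1) x = s x * q x" for x
    using H[of "q x - 1" x] q(4) by simp
  have upper: "H (q x - 1) x \<le> c + \<epsilon>" for x
    using q(5)[of x] unfolding Hq by linarith
  have lower: "H (q x - 1) x \<ge> c - \<epsilon>" for x
    using q(5)[of x] unfolding Hq by linarith
  have "continuous_on UNIV u"
    using DERIV_isCont[OF u(2)] by (simp add: continuous_on_eq_continuous_at)
  moreover have "viscosity_subsolution H (c + \<epsilon>) u"
    by (rule C1_viscosity_solution(1)[where H = H, OF u(2) upper])
  moreover have "viscosity_supersolution H (c - \<epsilon>) u"
    by (rule C1_viscosity_solution(2)[where H = H, OF u(2) lower])
  ultimately show ?thesis
    using u(1) by (intro exI[of _ u] conjI)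
qed

text \<open>The harmonic mean of \<open>s\<close> over a period when \<open>s\<close> is positive.
  The value 0 at a zero of \<open>s\<close> is the natural limit for Lipschitz \<open>s\<close>,
  where the integral of \<open>1 / \<bar>s\<bar>\<close> diverges.\<close>

definition flame_speed :: "(real \<Rightarrow> real) \<Rightarrow> real" where
  "flame_speed s = (if \<exists>x. s x = 0 then 0 else 1 / integral {0..1} (\<lambda>x. 1 / s x))"

lemma integral_pos:
  fixes f :: "real \<Rightarrow> real"
  assumes "continuous_on {0..1} f" "\<And>x. f x > 0"
  shows "integral {0..1} f > 0"
proof -
  have "integral {0..1} f \<ge> 0"
    using assms by (intro integral_nonneg integrable_continuous_real) (auto intro: less_imp_le)
  moreover have "integral {0..1} f \<noteq> 0"
    using integral_eq_0_iff[OF assms(1)] assms(2)[THEN less_imp_le] assms(2)[of 0] by fastforce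
  ultimately show ?thesis by simp
qed

text \<open>By the intermediate value theorem a negative value would make \<open>s\<close>
  nonpositive everywhere, against its mean.\<close>

lemma nonvanishing_mean_one_pos:
  fixes s :: "real \<Rightarrow> real"
  assumes cont: "continuous_on UNIV s" and int: "integral {0..1} s = 1" and nz: "\<And>x. s x \<noteq> 0"
  shows "s x > 0"
proof (rule ccontr)
  assume "\<not> s x > 0"
  then have neg: "s x < 0" using nz[of x] by auto
  have "s y \<le> 0" for y
  proof -
    have "{s x..s y} \<subseteq> range s"
      by (rule connected_contains_Icc[OF connected_continuous_image[OF cont connected_UNIV]]) auto
    moreover have "0 \<notin> range s"
      using nz by (metis rangeE)
    ultimately have "0 \<notin> {s x..s y}"
      by blast
    with neg show ?thesis by simp
  qed
  then have "integral {0..1} s \<le> integral {0..1} (\<lambda>_::real. 0::real)"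
    using continuous_on_subset[OF cont subset_UNIV]
    by (intro integral_le integrable_continuous_real) auto
  with int show False by simp
qed

text \<open>To the right of a zero \<open>x0\<close>, \<open>\<bar>s x\<bar>\<close> is at most
  \<open>M * (x - x0)\<close>, so the integrand dominates a function whose integral grows like
  \<open>ln (1 / \<delta>) / M\<close> as \<open>\<delta>\<close> tends to 0.\<close>

lemma regularized_reciprocal_integral_large:
  fixes s :: "real \<Rightarrow> real"
  assumes per: "periodic_fun_simple' s" and lip: "\<And>x y. \<bar>s x - s y\<bar> \<le> L * \<bar>x - y\<bar>"
    and zero: "s z = 0"
  shows "\<exists>\<delta>>0. integral {0..1} (\<lambda>x. 1 / (\<bar>s x\<bar> + \<delta>)) \<ge> B"
proof -
  \<comment> \<open>Taking the fractional part gives \<open>x0 < 1\<close>, so the interval from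
    \<open>x0\<close> to 1 is nondegenerate even for a zero at an integer.\<close>
  define x0 where "x0 = frac z"
  have x0: "0 \<le> x0" "x0 < 1" "s x0 = 0"
    using periodic_frac[OF per] zero by (auto simp: x0_def frac_lt_1)
  define M where "M = \<bar>L\<bar> + 1"
  have M: "M > 0" "L \<le> M" by (simp_all add: M_def)
  have lipM: "\<bar>s x - s y\<bar> \<le> M * \<bar>x - y\<bar>" for x y
    using lip[of x y] mult_right_mono[OF M(2), of "\<bar>x - y\<bar>"] by simp
  have bd: "\<bar>s x\<bar> \<le> M * \<bar>x - x0\<bar>" for x
    using lipM[of x x0] x0(3) by simp
  have cont: "continuous_on UNIV s"
    using M(1) lipM by (intro lipschitz_on_continuous_on[of M] lipschitz_onI) (auto simp: dist_real_def)
  \<comment> \<open>Solves \<open>(M * (1 - x0) + \<delta>) / \<delta> = exp (M * B) + 1\<close>;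
    the logarithm of the left side, divided by \<open>M\<close>, is the integral of the lower
    bound.\<close>
  define \<delta> where "\<delta> = M * (1 - x0) / exp (M * B)"
  have \<delta>: "\<delta> > 0"
    using M x0 by (simp add: \<delta>_def)
  have pos: "\<bar>s x\<bar> + \<delta> > 0" for x
    using \<delta> by (simp add: add_nonneg_pos)
  have cont': "continuous_on S (\<lambda>x. 1 / (\<bar>s x\<bar> + \<delta>))" for S
    by (intro continuous_intros continuous_on_subset[OF cont]) (use pos in \<open>auto simp: less_le\<close>)
  define G where "G = (\<lambda>x. ln (M * (x - x0) + \<delta>) / M)"
  have "((\<lambda>x. 1 / (M * (x - x0) + \<delta>)) has_integral (G 1 - G x0)) {x0..1}"
  proof (rule fundamental_theorem_of_calculus)
    fix x assume "x \<in> {x0..1}"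
    then have "M * (x - x0) + \<delta> > 0"
      using M \<delta> by (intro add_nonneg_pos) auto
    then show "(G has_vector_derivative 1 / (M * (x - x0) + \<delta>)) (at x within {x0..1})"
      unfolding G_def has_real_derivative_iff_has_vector_derivative[symmetric]
      using M by (auto intro!: derivative_eq_intros)
  qed (use x0 in auto)
  moreover have "integral {x0..1} (\<lambda>x. 1 / (M * (x - x0) + \<delta>)) \<le> integral {x0..1} (\<lambda>x. 1 / (\<bar>s x\<bar> + \<delta>))"
  proof (rule integral_le)
    show "1 / (M * (x - x0) + \<delta>) \<le> 1 / (\<bar>s x\<bar> + \<delta>)" if "x \<in> {x0..1}" for x
      using that bd[of x] pos[of x] by (intro divide_left_mono mult_pos_pos) auto
  qed (use calculation cont' in \<open>auto intro: integrable_continuous_real\<close>)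
  moreover have "\<dots> \<le> integral {0..1} (\<lambda>x. 1 / (\<bar>s x\<bar> + \<delta>))"
    using x0 pos cont' by (intro integral_subset_le integrable_continuous_real) (auto intro: less_imp_le)
  moreover have "B \<le> G 1 - G x0"
  proof -
    have "M * B = ln (exp (M * B))" by simp
    also have "\<dots> \<le> ln (exp (M * B) + 1)"
      by (subst ln_le_cancel_iff) (auto intro: add_pos_pos)
    also have "exp (M * B) + 1 = (M * (1 - x0) + \<delta>) / \<delta>"
      using M x0 by (simp add: \<delta>_def field_simps)
    also have "ln \<dots> = ln (M * (1 - x0) + \<delta>) - ln \<delta>"
      using M x0 \<delta> by (intro ln_divide_pos add_pos_pos) auto
    finally show ?thesis
      using M by (simp add: G_def field_simps)
  qed
  ultimately have "B \<le> integral {0..1} (\<lambda>x. 1 / (\<bar>s x\<bar> + \<delta>))"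
    by (simp add: integral_unique)
  with \<delta> show ?thesis by blast
qed

text \<open>Dividing a positive density by its integral gives an admissible slope of mean 1, which
  leaves only the deviation of \<open>s * r\<close> from a constant to be estimated.\<close>

lemma approx_solution_of_density:
  fixes H :: "real \<Rightarrow> real \<Rightarrow> real"
  assumes H: "\<And>p x. 1 + p \<ge> 0 \<Longrightarrow> H p x = s x * (1 + p)"
    and r: "continuous_on UNIV r" "periodic_fun_simple' r" "\<And>x. r x > 0"
    and bd: "\<And>x. \<bar>s x * r x / integral {0..1} r - c\<bar> \<le> \<epsilon>"
  shows "\<exists>u. continuous_on UNIV u \<and> periodic_fun_simple' u \<and>
           viscosity_subsolution H (c + \<epsilon>) u \<and> viscosity_supersolution H (c - \<epsilon>) u"
proof (rule approx_solution_of_slope[OF H, where q = "\<lambda>x. r x / integral {0..1} r"])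
  have pos: "integral {0..1} r > 0"
    by (rule integral_pos[OF continuous_on_subset[OF r(1) subset_UNIV] r(3)])
  show "continuous_on UNIV (\<lambda>x. r x / integral {0..1} r)"
    using pos by (intro continuous_intros r(1)) simp
  show "periodic_fun_simple' (\<lambda>x. r x / integral {0..1} r)"
    using r(2) by (simp add: periodic_fun_simple'_def)
  show "integral {0..1} (\<lambda>x. r x / integral {0..1} r) = 1"
    using pos by simp
  show "r x / integral {0..1} r \<ge> 0" for x
    using pos r(3)[of x] by simp
  show "\<bar>s x * (r x / integral {0..1} r) - c\<bar> \<le> \<epsilon>" for x
    using bd[of x] by simp
qed

lemma admits_zero_of_vanishing_speed:
  fixes H :: "real \<Rightarrow> real \<Rightarrow> real"
  assumes H: "\<And>p x. 1 + p \<ge> 0 \<Longrightarrow> H p x = s x * (1 + p)"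
    and per: "periodic_fun_simple' s" and lip: "\<And>x y. \<bar>s x - s y\<bar> \<le> L * \<bar>x - y\<bar>"
    and cont: "continuous_on UNIV s" and zero: "s z = 0"
  shows "admits_approx_solutions H 0"
  unfolding admits_approx_solutions_def
proof (intro allI impI)
  fix \<epsilon> :: real assume \<epsilon>: "\<epsilon> > 0"
  \<comment> \<open>Since \<open>\<bar>s x * r x\<bar>\<close> is at most 1 for every
    \<open>\<delta>\<close>, an integral of at least \<open>1 / \<epsilon>\<close> brings the
    normalized product below \<open>\<epsilon>\<close>.\<close>
  obtain \<delta> where \<delta>: "\<delta> > 0" "integral {0..1} (\<lambda>x. 1 / (\<bar>s x\<bar> + \<delta>)) \<ge> 1 / \<epsilon>"
    using regularized_reciprocal_integral_large[OF per lip zero] by blast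
  define r where "r x = 1 / (\<bar>s x\<bar> + \<delta>)" for x
  have pos: "\<bar>s x\<bar> + \<delta> > 0" for x
    using \<delta>(1) by (simp add: add_nonneg_pos)
  have I: "integral {0..1} r \<ge> 1 / \<epsilon>" "integral {0..1} r > 0"
    using \<delta>(2) \<epsilon> less_le_trans[of 0 "1 / \<epsilon>" "integral {0..1} r"] by (simp_all add: r_def[abs_def])
  show "\<exists>u. continuous_on UNIV u \<and> periodic_fun_simple' u \<and>
      viscosity_subsolution H (0 + \<epsilon>) u \<and> viscosity_supersolution H (0 - \<epsilon>) u"
  proof (rule approx_solution_of_density[OF H])
    show "r x > 0" for x
      using pos by (simp add: r_def)
    show "continuous_on UNIV r"
      unfolding r_def by (intro continuous_intros cont) (use pos in \<open>auto simp: less_le\<close>)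
    show "periodic_fun_simple' r"
      using per by (simp add: r_def periodic_fun_simple'_def)
    fix x
    have "\<bar>s x * r x\<bar> \<le> 1"
      using pos[of x] \<delta>(1) by (simp add: r_def abs_mult field_simps)
    then have "\<bar>s x * r x / integral {0..1} r\<bar> \<le> 1 / integral {0..1} r"
      using I(2) by (simp add: divide_right_mono)
    also have "\<dots> \<le> \<epsilon>"
      using I \<epsilon> by (simp add: field_simps)
    finally show "\<bar>s x * r x / integral {0..1} r - 0\<bar> \<le> \<epsilon>"
      by simp
  qed
qed

lemma admits_harmonic_mean_speed:
  fixes H :: "real \<Rightarrow> real \<Rightarrow> real"
  assumes H: "\<And>p x. 1 + p \<ge> 0 \<Longrightarrow> H p x = s x * (1 + p)"
    and per: "periodic_fun_simple' s" and cont: "continuous_on UNIV s" and pos: "\<And>x. s x > 0"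
  shows "admits_approx_solutions H (1 / integral {0..1} (\<lambda>x. 1 / s x))"
  unfolding admits_approx_solutions_def
proof (intro allI impI approx_solution_of_density[OF H])
  have nz: "s x \<noteq> 0" for x
    using pos[of x] by simp
  show "continuous_on UNIV (\<lambda>x. 1 / s x)"
    using nz by (intro continuous_intros cont) simp
  show "periodic_fun_simple' (\<lambda>x. 1 / s x)"
    using per by (simp add: periodic_fun_simple'_def)
  show "1 / s x > 0" for x
    using pos by simp
  show "\<bar>s x * (1 / s x) / integral {0..1} (\<lambda>x. 1 / s x) - 1 / integral {0..1} (\<lambda>x. 1 / s x)\<bar> \<le> \<epsilon>"
    if "\<epsilon> > 0" for \<epsilon> x
    using that nz by simp
qed

lemma admits_flame_speed:
  fixes H :: "real \<Rightarrow> real \<Rightarrow> real"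
  assumes H: "\<And>p x. 1 + p \<ge> 0 \<Longrightarrow> H p x = s x * (1 + p)"
    and per: "periodic_fun_simple' s" and lip: "\<And>x y. \<bar>s x - s y\<bar> \<le> L * \<bar>x - y\<bar>"
    and cont: "continuous_on UNIV s" and int: "integral {0..1} s = 1"
  shows "admits_approx_solutions H (flame_speed s)"
proof (cases "\<exists>z. s z = 0")
  case True
  then obtain z where "s z = 0" by blast
  with True show ?thesis
    using admits_zero_of_vanishing_speed[OF H per lip cont] by (simp add: flame_speed_def)
next
  case False
  then have "s x > 0" for x
    using nonvanishing_mean_one_pos[OF cont int] by blast
  with False show ?thesis
    using admits_harmonic_mean_speed[OF H per cont] by (simp add: flame_speed_def)
qed

section \<open>The effect of strain\<close>

text \<open>The mean rules out a nonvanishing negative \<open>s\<close>, so the sign of the speed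
  only records whether \<open>s\<close> has a zero.\<close>

lemma flame_speed_pos_iff:
  assumes cont: "continuous_on UNIV s" and int: "integral {0..1} s = 1"
  shows "flame_speed s > 0 \<longleftrightarrow> (\<forall>x. s x > 0)"
proof
  assume "flame_speed s > 0"
  then have "\<And>x. s x \<noteq> 0" by (auto simp: flame_speed_def split: if_splits)
  then show "\<forall>x. s x > 0" using nonvanishing_mean_one_pos[OF cont int] by blast
next
  assume pos: "\<forall>x. s x > 0"
  then have "integral {0..1} (\<lambda>x. 1 / s x) > 0"
    by (intro integral_pos continuous_intros continuous_on_subset[OF cont]) (auto simp: less_le)
  moreover have "\<nexists>x. s x = 0" using pos by (metis less_irrefl)
  ultimately show "flame_speed s > 0" by (simp add: flame_speed_def)
qed

text \<open>The function \<open>e\<^sup>x f x\<close> is increasing, and a period multiplies it by \<open>e > 1\<close>.\<close>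

lemma periodic_pos_of_add_deriv_pos:
  fixes f f' :: "real \<Rightarrow> real"
  assumes per: "periodic_fun_simple' f" and der: "\<And>x. (f has_real_derivative f' x) (at x)"
    and pos: "\<And>x. f x + f' x > 0"
  shows "f x > 0"
proof -
  have D: "((\<lambda>x. exp x * f x) has_real_derivative exp x * (f x + f' x)) (at x)" for x
    by (auto intro!: derivative_eq_intros der simp: algebra_simps)
  have "exp x * f x < exp (x + 1) * f (x + 1)"
  proof (rule DERIV_pos_imp_increasing[of x "x + 1" "\<lambda>x. exp x * f x"])
    show "\<exists>y. ((\<lambda>x. exp x * f x) has_real_derivative y) (at z) \<and> y > 0" for z
      using D[of z] pos[of z] by (intro exI[of _ "exp z * (f z + f' z)"]) simp
  qed simp
  then have "0 < exp x * ((exp 1 - 1) * f x)"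
    unfolding periodic_fun_simple'.plus_period[OF per] by (simp add: exp_add algebra_simps)
  then have "0 < (exp 1 - 1) * f x"
    by (simp add: zero_less_mult_iff)
  moreover have "exp 1 - 1 > (0::real)" by simp
  ultimately show ?thesis
    using zero_less_mult_pos by blast
qed

text \<open>The difference of the two integrals is the integral of the nonnegative \<open>R\<close>,
  because \<open>f' / f^2\<close> is the derivative of \<open>- 1 / f\<close> and integrates to 0
  over a period. Equality forces the continuous \<open>R\<close>, hence \<open>f'\<close>, to
  vanish.\<close>

lemma integral_reciprocal_add_deriv:
  fixes f f' :: "real \<Rightarrow> real"
  assumes per: "periodic_fun_simple' f" and der: "\<And>x. (f has_real_derivative f' x) (at x)"
    and cont': "continuous_on UNIV f'" and pos: "\<And>x. f x + f' x > 0"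
  shows "integral {0..1} (\<lambda>x. 1 / f x) \<le> integral {0..1} (\<lambda>x. 1 / (f x + f' x))"
    and "integral {0..1} (\<lambda>x. 1 / f x) = integral {0..1} (\<lambda>x. 1 / (f x + f' x)) \<Longrightarrow> f' x = 0"
proof -
  have fpos: "f x > 0" for x
    using periodic_pos_of_add_deriv_pos[OF per der pos] .
  have nz: "f x \<noteq> 0" "f x + f' x \<noteq> 0" for x
    using fpos[of x] pos[of x] by auto
  have cont: "continuous_on UNIV f"
    using der DERIV_isCont by (auto simp: continuous_on_eq_continuous_at)
  note cs = continuous_intros continuous_on_subset[OF cont] continuous_on_subset[OF cont']
  define R where "R x = (f' x)^2 / ((f x)^2 * (f x + f' x))" for x
  have R: "R x = 1 / (f x + f' x) - 1 / f x + f' x / (f x)^2" for x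
  proof -
    \<comment> \<open>Used with \<open>a = f x\<close> and \<open>b = f x + f' x\<close>.\<close>
    have "(b - a)^2 / (a^2 * b) = 1 / b - 1 / a + (b - a) / a^2" if "a \<noteq> 0" "b \<noteq> 0" for a b :: real
      using that by (simp add: field_simps power2_eq_square)
    from this[OF nz, of x x] show ?thesis by (simp add: R_def)
  qed
  have contR: "continuous_on {0..1} R"
    unfolding R_def by (intro cs) (use nz in auto)
  have R0: "R x \<ge> 0" for x
    using fpos[of x] pos[of x] by (simp add: R_def)
  have "((\<lambda>x. f' x / (f x)^2) has_integral (- (1 / f 1) - - (1 / f 0))) {0..1}"
    by (rule fundamental_theorem_of_calculus)
       (use nz in \<open>auto intro!: derivative_eq_intros has_field_derivative_at_within[OF der]
          simp: power2_eq_square simp flip: has_real_derivative_iff_has_vector_derivative\<close>)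
  then have I0: "((\<lambda>x. f' x / (f x)^2) has_integral 0) {0..1}"
    using periodic_fun_simple'.plus_period[OF per, of 0] by simp
  have ii: "(\<lambda>x. 1 / f x) integrable_on {0..1}" "(\<lambda>x. 1 / (f x + f' x)) integrable_on {0..1}"
    by (intro integrable_continuous_real cs; use nz in auto)+
  have "(R has_integral (integral {0..1} (\<lambda>x. 1 / (f x + f' x)) - integral {0..1} (\<lambda>x. 1 / f x) + 0)) {0..1}"
    unfolding R by (intro has_integral_add has_integral_diff I0 integrable_integral ii)
  then have IR: "integral {0..1} R = integral {0..1} (\<lambda>x. 1 / (f x + f' x)) - integral {0..1} (\<lambda>x. 1 / f x)"
    by (simp add: integral_unique)
  have "integral {0..1} R \<ge> 0"
    using R0 contR by (intro integral_nonneg integrable_continuous_real) auto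
  with IR show "integral {0..1} (\<lambda>x. 1 / f x) \<le> integral {0..1} (\<lambda>x. 1 / (f x + f' x))" by simp
  assume "integral {0..1} (\<lambda>x. 1 / f x) = integral {0..1} (\<lambda>x. 1 / (f x + f' x))"
  then have "integral {0..1} R = 0"
    using IR by simp
  \<comment> \<open>The vanishing integral gives information on one period only; periodicity of
    \<open>f'\<close> carries it to all \<open>x\<close>.\<close>
  then have "R (frac x) = 0"
    using integral_eq_0_iff[OF contR] R0 by (simp add: frac_lt_1 less_imp_le)
  then show "f' x = 0"
    using nz[of "frac x"] periodic_frac[OF periodic_deriv[OF per der], of x] by (simp add: R_def)
qed

text \<open>If the strained speed is not positive, the inequality is just nonnegativity of
  \<open>flame_speed f\<close>. If it is positive, both \<open>f + f'\<close> and \<open>f\<close>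
  are positive and the reciprocal integrals can be compared; equality with a positive
  \<open>flame_speed f\<close> always falls into this case.\<close>

lemma flame_speed_strain:
  fixes f f' :: "real \<Rightarrow> real"
  assumes per: "periodic_fun_simple' f" and der: "\<And>x. (f has_real_derivative f' x) (at x)"
    and cont': "continuous_on UNIV f'"
    and int: "integral {0..1} f = 1" "integral {0..1} (\<lambda>x. f x + f' x) = 1"
  shows "flame_speed (\<lambda>x. f x + f' x) \<le> flame_speed f"
    and "flame_speed f > 0 \<Longrightarrow> flame_speed f = flame_speed (\<lambda>x. f x + f' x) \<longleftrightarrow> (\<forall>x. f' x = 0)"
proof -
  let ?g = "\<lambda>x. f x + f' x"
  have cont: "continuous_on UNIV f"
    using der DERIV_isCont by (auto simp: continuous_on_eq_continuous_at)
  have contg: "continuous_on UNIV ?g"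
    by (intro continuous_intros cont cont')
  have pos: "flame_speed f > 0 \<longleftrightarrow> (\<forall>x. f x > 0)" "flame_speed ?g > 0 \<longleftrightarrow> (\<forall>x. ?g x > 0)"
    using flame_speed_pos_iff cont contg int by auto
  have nonneg: "flame_speed f \<ge> 0"
    using nonvanishing_mean_one_pos[OF cont int(1)] pos(1)
    by (cases "\<exists>x. f x = 0") (auto simp: flame_speed_def intro: less_imp_le)
  have gpos: "flame_speed ?g \<le> flame_speed f \<and> (flame_speed f = flame_speed ?g \<longrightarrow> (\<forall>x. f' x = 0))"
    if "flame_speed ?g > 0"
  proof -
    have g: "?g x > 0" for x using that pos by blast
    have f: "f x > 0" for x
      using periodic_pos_of_add_deriv_pos[OF per der g] .
    have nz: "\<nexists>x. f x = 0" "\<nexists>x. ?g x = 0" using f g by (metis less_irrefl)+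
    define A where "A = integral {0..1} (\<lambda>x. 1 / f x)"
    define B where "B = integral {0..1} (\<lambda>x. 1 / ?g x)"
    have speeds: "flame_speed f = 1 / A" "flame_speed ?g = 1 / B"
      using nz by (simp_all add: flame_speed_def A_def B_def)
    have "A > 0"
      unfolding A_def using f
      by (intro integral_pos continuous_intros continuous_on_subset[OF cont]) (auto simp: less_le)
    moreover have "A \<le> B" "A = B \<Longrightarrow> f' x = 0" for x
      unfolding A_def B_def by (fact integral_reciprocal_add_deriv[OF per der cont' g])+
    ultimately show ?thesis
      unfolding speeds by (simp add: frac_le)
  qed
  then show "flame_speed ?g \<le> flame_speed f"
    using nonneg by linarith
  show "flame_speed f = flame_speed ?g \<longleftrightarrow> (\<forall>x. f' x = 0)" if "flame_speed f > 0"
  proof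
    assume eq: "flame_speed f = flame_speed ?g"
    then have "flame_speed ?g > 0"
      using that by (rule subst)
    with gpos eq show "\<forall>x. f' x = 0" by blast
  next
    assume "\<forall>x. f' x = 0"
    then show "flame_speed f = flame_speed ?g" by simp
  qed
qed

section \<open>Effective constants of the two G-equations\<close>

lemma effective_constant_eqI:
  fixes H :: "real \<Rightarrow> real \<Rightarrow> real"
  assumes "\<And>p x y. \<bar>H p x - H p y\<bar> \<le> L * (1 + \<bar>p\<bar>) * \<bar>x - y\<bar>" "L \<ge> 0"
    and "admits_approx_solutions H c"
  shows "\<exists>!c. admits_approx_solutions H c" "effective_constant H = c"
proof -
  have uniq: "d = c" if "admits_approx_solutions H d" for d
    using admits_approx_solutions_unique[OF assms(1,2) that assms(3)] .
  with assms(3) show "\<exists>!c. admits_approx_solutions H c"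
    by (rule ex1I)
  show "effective_constant H = c"
    unfolding effective_constant_def using assms(3) uniq by (rule the_equality)
qed

theorem theorem2p1:
  fixes v :: "real \<Rightarrow> real"
  assumes "smooth v" and "periodic_fun_simple' v" and "integral {0..1} v = 0"
  shows "(\<exists>!c. admits_approx_solutions (G_hamiltonian v) c) \<and>
    (\<exists>!c. admits_approx_solutions (strain_G_hamiltonian v) c) \<and>
    (let c = effective_constant (G_hamiltonian v);
         c' = effective_constant (strain_G_hamiltonian v)
     in c \<ge> c' \<and> (c > 0 \<longrightarrow> (c = c' \<longleftrightarrow> (\<forall>x. deriv v x = 0))))"
proof -
  let ?v' = "deriv v"
  let ?f = "\<lambda>x. 1 + v x"
  let ?g = "\<lambda>x. 1 + v x + ?v' x"
  have iter: "((deriv ^^ n) v has_real_derivative (deriv ^^ Suc n) v x) (at x)" for n x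
    using assms(1) DERIV_deriv_iff_real_differentiable
    by (simp add: smooth_def differentiable_on_def)
  have der: "(v has_real_derivative ?v' x) (at x)" for x
    using iter[of 0] by simp
  have der': "(?v' has_real_derivative deriv ?v' x) (at x)" for x
    using iter[of 1] by simp
  have cont: "continuous_on UNIV v" "continuous_on UNIV ?v'" "continuous_on UNIV (deriv ?v')"
    using DERIV_isCont[OF iter[of 0]] DERIV_isCont[OF iter[of 1]] DERIV_isCont[OF iter[of 2]]
    by (auto simp: continuous_on_eq_continuous_at numeral_2_eq_2)
  have per': "periodic_fun_simple' ?v'"
    by (rule periodic_deriv[OF assms(2) der])
  obtain L where L: "L \<ge> 0" "\<And>x y. \<bar>v x - v y\<bar> \<le> L * \<bar>x - y\<bar>"
    using periodic_C1_lipschitz[OF assms(2) der cont(2)] by auto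
  obtain L' where L': "L' \<ge> 0" "\<And>x y. \<bar>?v' x - ?v' y\<bar> \<le> L' * \<bar>x - y\<bar>"
    using periodic_C1_lipschitz[OF per' der' cont(3)] by auto
  have lip: "\<bar>(v x - v y) * (1 + p)\<bar> \<le> L * (1 + \<bar>p\<bar>) * \<bar>x - y\<bar>" for p x y
    using mult_mono[OF L(2)[of x y], of "\<bar>1 + p\<bar>" "1 + \<bar>p\<bar>"] L(1)
    by (simp add: abs_mult mult_ac)
  have lip': "\<bar>(?v' x - ?v' y) * \<bar>1 + p\<bar>\<bar> \<le> L' * (1 + \<bar>p\<bar>) * \<bar>x - y\<bar>" for p x y
    using mult_mono[OF L'(2)[of x y], of "\<bar>1 + p\<bar>" "1 + \<bar>p\<bar>"] L'(1)
    by (simp add: abs_mult mult_ac)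
  \<comment> \<open>The term \<open>\<bar>1 + p\<bar>\<close> does not depend on \<open>x\<close>
    and cancels.\<close>
  have HG: "\<bar>G_hamiltonian v p x - G_hamiltonian v p y\<bar> \<le> L * (1 + \<bar>p\<bar>) * \<bar>x - y\<bar>" for p x y
    using lip[of x y p] by (simp add: G_hamiltonian_def algebra_simps)
  have HS: "\<bar>strain_G_hamiltonian v p x - strain_G_hamiltonian v p y\<bar>
      \<le> (L + L') * (1 + \<bar>p\<bar>) * \<bar>x - y\<bar>" for p x y
  proof -
    have "strain_G_hamiltonian v p x - strain_G_hamiltonian v p y
        = (v x - v y) * (1 + p) + (?v' x - ?v' y) * \<bar>1 + p\<bar>"
      by (simp add: strain_G_hamiltonian_def algebra_simps)
    also have "\<bar>\<dots>\<bar> \<le> L * (1 + \<bar>p\<bar>) * \<bar>x - y\<bar> + L' * (1 + \<bar>p\<bar>) * \<bar>x - y\<bar>"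
      by (rule order_trans[OF abs_triangle_ineq add_mono[OF lip lip']])
    finally show ?thesis
      by (simp add: distrib_right)
  qed
  \<comment> \<open>Periodicity gives \<open>deriv v\<close> mean zero, so adding the strain keeps
    the mean equal to 1.\<close>
  have "(?v' has_integral (v 1 - v 0)) {0..1}"
    by (rule fundamental_theorem_of_calculus)
       (auto intro!: has_field_derivative_at_within der simp flip: has_real_derivative_iff_has_vector_derivative)
  then have i': "(?v' has_integral 0) {0..1}"
    using periodic_fun_simple'.plus_period[OF assms(2), of 0] by simp
  have "v integrable_on {0..1}"
    using continuous_on_subset[OF cont(1) subset_UNIV] by (intro integrable_continuous_real) auto
  then have i: "(v has_integral 0) {0..1}"
    using assms(3) integrable_integral by metis
  have c1: "((\<lambda>_::real. 1::real) has_integral 1) {0..1}"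
    using has_integral_const_real[of "1::real" 0 1] by simp
  have intf: "integral {0..1} ?f = 1"
    using has_integral_add[OF c1 i] by (simp add: integral_unique)
  have intg: "integral {0..1} ?g = 1"
    using has_integral_add[OF has_integral_add[OF c1 i] i'] by (simp add: integral_unique)
  have perf: "periodic_fun_simple' ?f" "periodic_fun_simple' ?g"
    using assms(2) per' by (simp_all add: periodic_fun_simple'_def)
  have admG: "admits_approx_solutions (G_hamiltonian v) (flame_speed ?f)"
    by (rule admits_flame_speed[where L = L])
       (use perf intf L in \<open>auto simp: G_hamiltonian_def algebra_simps intro!: continuous_intros cont\<close>)
  have "\<bar>?g x - ?g y\<bar> \<le> (L + L') * \<bar>x - y\<bar>" for x y
    using L(2)[of x y] L'(2)[of x y] by (simp add: distrib_right)
  then have admS: "admits_approx_solutions (strain_G_hamiltonian v) (flame_speed ?g)"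
    by (intro admits_flame_speed[where L = "L + L'"])
       (use perf intg in \<open>auto simp: strain_G_hamiltonian_def algebra_simps intro!: continuous_intros cont\<close>)
  have derf: "(?f has_real_derivative ?v' x) (at x)" for x
    by (auto intro!: derivative_eq_intros der)
  show ?thesis
    using effective_constant_eqI[OF HG L(1) admG] effective_constant_eqI[OF HS _ admS] L(1) L'(1)
      flame_speed_strain[OF perf(1) derf cont(2) intf intg]
    by (simp add: Let_def)
qed

end
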